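(* Let $n\ge 1$ and let $T: S_n(\mathbb{R})\to S_n(\mathbb{R})$ be a linear operator preserving positive definiteness. Then $T$ satisfies the condition $T^{-1}(\mathcal{A})\subset\mathcal{A}$ if and only if there exists an invertible matrix $W\in M_n(\mathbb{R})$ such that for every $A\in S_n(\mathbb{R})$ $$T(A)=WAW^t.$$
   Context: $M_n(\mathbb{R})$ is the space of real $n\times n$ matrices and $S_n(\mathbb{R})$ is the real vector space of real symmetric $n\times n$ matrices. $\mathcal{A}\subset S_n(\mathbb{R})$ is the set of all positive definite symmetric matrices. $T$ preserves positive definiteness if $T(A)$ is positive definite whenever $A\in S_n(\mathbb{R})$ is positive definite. $T^{-1}(\mathcal{A})=\{A\in S_n(\mathbb{R}): T(A)\in\mathcal{A}\}$ denotes the preimage, so $T^{-1}(\mathcal{A})\subset\mathcal{A}$ means that $T(A)$ positive definite implies $A$ positive definite. *)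

theory Defs
  imports "HOL-Analysis.Analysis"
begin

definition sym_mats :: "(real ^ 'n ^ 'n) set" where
  "sym_mats = {A. transpose A = A}"

definition pos_def_mats :: "(real ^ 'n ^ 'n) set" where
  "pos_def_mats = {A \<in> sym_mats. \<forall>x. x \<noteq> 0 \<longrightarrow> x \<bullet> (A *v x) > 0}"

text \<open>
  An operator on symmetric matrices is a function on all square matrices that is
  constrained on \<^const>\<open>sym_mats\<close> only; its values elsewhere are irrelevant.
\<close>

definition linear_operator_on_sym_mats :: "(real ^ 'n ^ 'n \<Rightarrow> real ^ 'n ^ 'n) \<Rightarrow> bool" where
  "linear_operator_on_sym_mats T \<longleftrightarrow>
     T ` sym_mats \<subseteq> sym_mats \<and>
     (\<forall>A\<in>sym_mats. \<forall>B\<in>sym_mats. T (A + B) = T A + T B) \<and>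
     (\<forall>c. \<forall>A\<in>sym_mats. T (c *\<^sub>R A) = c *\<^sub>R T A)"

definition preserves_pos_def :: "(real ^ 'n ^ 'n \<Rightarrow> real ^ 'n ^ 'n) \<Rightarrow> bool" where
  "preserves_pos_def T \<longleftrightarrow> (\<forall>A\<in>sym_mats. A \<in> pos_def_mats \<longrightarrow> T A \<in> pos_def_mats)"

end

theory Submission
  imports Defs
begin

text \<open>
  If \<open>T A\<close> is positive definite exactly when \<open>A\<close> is, then \<open>T\<close> is injective, hence bijective, and
  \<open>T A\<close> is positive semidefinite exactly when \<open>A\<close> is. The diagonal matrix units span extreme rays of
  the semidefinite cone, so \<open>T\<close> sends them to rank-one matrices; if the latter are \<open>w\<^sub>i w\<^sub>i\<^sup>t\<close> and
  \<open>W\<close> has the columns \<open>w\<^sub>i\<close>, then \<open>W W\<^sup>t = T I\<close> is positive definite, so \<open>W\<close> is invertible. Thus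
  \<open>S A = W\<^sup>-\<^sup>1 (T A) W\<^sup>-\<^sup>t\<close> fixes the diagonal units. Semidefiniteness of 2 by 2 blocks, for \<open>S\<close> and
  its inverse, forces \<open>S\<close> to multiply each off-diagonal entry by a sign, and the image of the
  all-ones matrix being semidefinite forces the sign matrix to be \<open>d d\<^sup>t\<close>. So \<open>W diag(d)\<close> works.
\<close>

section \<open>Positive semidefinite matrices\<close>

definition pos_semidef :: "real ^ 'n ^ 'n \<Rightarrow> bool" where
  "pos_semidef A \<longleftrightarrow> A \<in> sym_mats \<and> (\<forall>x. 0 \<le> x \<bullet> (A *v x))"

lemma sym_mats_iff: "A \<in> sym_mats \<longleftrightarrow> (\<forall>i j. A $ i $ j = A $ j $ i)"
  by (auto simp: sym_mats_def transpose_def vec_eq_iff)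

lemma subspace_sym_mats: "subspace sym_mats"
  by (auto simp: subspace_def sym_mats_iff)

lemma mat_sym [simp]: "mat c \<in> sym_mats"
  by (auto simp: sym_mats_iff mat_def)

lemma congruence_sym_mats:
  fixes V :: "real ^ 'n ^ 'n"
  assumes "A \<in> sym_mats"
  shows "V ** A ** transpose V \<in> sym_mats"
  using assms by (simp add: sym_mats_def matrix_transpose_mul matrix_mul_assoc)

lemma inner_congruence:
  fixes V :: "real ^ 'n ^ 'n"
  shows "x \<bullet> ((V ** A ** transpose V) *v y) = (transpose V *v x) \<bullet> (A *v (transpose V *v y))"
  by (simp add: matrix_vector_mul_assoc [symmetric] dot_lmul_matrix)

lemma inner_mult_axis: "axis i 1 \<bullet> (A *v axis j 1) = (A :: real ^ 'n ^ 'n) $ i $ j"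
  by (simp add: inner_axis' matrix_vector_mult_basis column_def)

lemma sym_mats_inner_commute:
  assumes "A \<in> sym_mats"
  shows "x \<bullet> (A *v y) = y \<bullet> (A *v x)"
  using assms by (metis (mono_tags) dot_lmul_matrix inner_commute mem_Collect_eq sym_mats_def transpose_matrix_vector)

text \<open>On the span of \<open>x\<close> and \<open>y\<close> the form is a binary quadratic form
  in \<open>s\<close> and \<open>t\<close>; it is nonnegative everywhere, and suitable values of
  \<open>s\<close> and \<open>t\<close> give the discriminant inequality.\<close>

lemma pos_semidef_Cauchy_Schwarz:
  assumes "pos_semidef A"
  shows "(x \<bullet> (A *v y))\<^sup>2 \<le> (x \<bullet> (A *v x)) * (y \<bullet> (A *v y))"
proof -
  define a b c where "a = x \<bullet> (A *v x)" and "b = x \<bullet> (A *v y)" and "c = y \<bullet> (A *v y)"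
  have yx: "y \<bullet> (A *v x) = b"
    using assms sym_mats_inner_commute unfolding b_def pos_semidef_def by blast
  have ge: "0 \<le> s\<^sup>2 * a + 2 * s * t * b + t\<^sup>2 * c" for s t
  proof -
    have "0 \<le> (s *\<^sub>R x + t *\<^sub>R y) \<bullet> (A *v (s *\<^sub>R x + t *\<^sub>R y))"
      using assms by (simp add: pos_semidef_def)
    also have "\<dots> = s\<^sup>2 * a + 2 * s * t * b + t\<^sup>2 * c"
      by (simp add: matrix_vector_right_distrib matrix_vector_mult_scaleR inner_add yx
          a_def [symmetric] b_def [symmetric] c_def [symmetric] algebra_simps power2_eq_square)
    finally show ?thesis .
  qed
  have "a \<ge> 0" "c \<ge> 0" using ge [of 1 0] ge [of 0 1] by auto
  show ?thesis
  proof (cases "a = 0")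
    case False
    \<comment> \<open>The choice \<open>s = b\<close>, \<open>t = - a\<close> is the minimiser over
      \<open>s\<close> up to scaling, so the form becomes \<open>a\<close> times the discriminant
      term.\<close>
    have "0 \<le> a * (a * c - b\<^sup>2)"
      using ge [of b "- a"] by (simp add: algebra_simps power2_eq_square)
    with False \<open>a \<ge> 0\<close> have "b\<^sup>2 \<le> a * c"
      by (simp add: zero_le_mult_iff)
    then show ?thesis by (simp add: a_def b_def c_def)
  next
    case True
    have "b = 0"
    proof (rule ccontr)
      assume "b \<noteq> 0"
      \<comment> \<open>With \<open>a = 0\<close> and \<open>t = 1\<close> the form is affine in
        \<open>s\<close>; this \<open>s\<close> makes its value -1.\<close>
      then have "2 * (- (c + 1) / (2 * b)) * b = - (c + 1)" by simp
      then show False using ge [of "- (c + 1) / (2 * b)" 1] True by simp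
    qed
    then show ?thesis using True by (simp add: a_def b_def c_def)
  qed
qed

text \<open>By Cauchy-Schwarz, \<open>A *v y\<close> is orthogonal to every vector. Isotropic
  vectors of a semidefinite form thus lie in its kernel.\<close>

lemma pos_semidef_null:
  assumes "pos_semidef A" "y \<bullet> (A *v y) = 0"
  shows "A *v y = 0"
proof -
  have "(x \<bullet> (A *v y))\<^sup>2 \<le> 0" for x
    using pos_semidef_Cauchy_Schwarz [OF assms(1), of x y] assms(2) by simp
  then show ?thesis by (metis inner_eq_zero_iff power2_less_eq_zero_iff)
qed

lemma pos_semidef_minor:
  fixes A :: "real ^ 'n ^ 'n"
  assumes "pos_semidef A"
  shows "(A $ i $ j)\<^sup>2 \<le> A $ i $ i * A $ j $ j"
  using pos_semidef_Cauchy_Schwarz [OF assms, of "axis i 1" "axis j 1"]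
  by (simp add: inner_mult_axis)

lemma pos_semidef_diag:
  fixes A :: "real ^ 'n ^ 'n"
  assumes "pos_semidef A"
  shows "0 \<le> A $ i $ i"
  using assms inner_mult_axis [of i A i] unfolding pos_semidef_def by metis

text \<open>This characterises semidefiniteness by definiteness alone, so that it can be carried
  through a linear operator. A general \<open>P\<close> is allowed because \<open>mat 1\<close> on
  one side becomes \<open>T (mat 1)\<close> on the other.\<close>

lemma pos_semidef_iff_perturb:
  assumes "A \<in> sym_mats" "P \<in> pos_def_mats"
  shows "pos_semidef A \<longleftrightarrow> (\<forall>e>0. A + e *\<^sub>R P \<in> pos_def_mats)"
proof
  have quad: "x \<bullet> ((A + e *\<^sub>R P) *v x) = x \<bullet> (A *v x) + e * (x \<bullet> (P *v x))" for x and e :: real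
    by (simp add: matrix_vector_mult_add_rdistrib scaleR_matrix_vector_assoc [symmetric] inner_add)
  have sym: "A + e *\<^sub>R P \<in> sym_mats" for e :: real
    using assms subspace_sym_mats by (auto simp: pos_def_mats_def subspace_def)
  {
    assume "pos_semidef A"
    then show "\<forall>e>0. A + e *\<^sub>R P \<in> pos_def_mats"
      using assms sym by (auto simp: pos_def_mats_def pos_semidef_def quad add_nonneg_pos)
  next
    assume pd: "\<forall>e>0. A + e *\<^sub>R P \<in> pos_def_mats"
    have "0 \<le> x \<bullet> (A *v x)" for x
    proof (cases "x = 0")
      case False
      then have p: "x \<bullet> (P *v x) > 0" using assms by (auto simp: pos_def_mats_def)
      show ?thesis
      proof (rule field_le_epsilon)
        fix e :: real assume "e > 0"
        \<comment> \<open>Dividing by the value of \<open>P\<close> at \<open>x\<close> makes the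
          perturbation contribute exactly \<open>e\<close>.\<close>
        then have "e / (x \<bullet> (P *v x)) > 0" using p by simp
        with pd False have "0 < x \<bullet> ((A + (e / (x \<bullet> (P *v x))) *\<^sub>R P) *v x)"
          unfolding pos_def_mats_def by blast
        then show "0 \<le> x \<bullet> (A *v x) + e" using p by (simp add: quad)
      qed
    qed simp
    then show "pos_semidef A" using assms by (simp add: pos_semidef_def)
  }
qed

lemma matrix_add_rdistrib: "(A + B) ** C = A ** C + B ** (C :: real ^ 'n ^ 'm)"
  by (simp add: matrix_matrix_mult_def vec_eq_iff distrib_right sum.distrib)

lemma pos_semidef_congruence:
  fixes V :: "real ^ 'n ^ 'n"
  assumes "pos_semidef A"
  shows "pos_semidef (V ** A ** transpose V)"
  using assms by (simp add: pos_semidef_def congruence_sym_mats inner_congruence)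

lemma congruence_inverse:
  fixes V W :: "real ^ 'n ^ 'n"
  assumes "V ** W = mat 1"
  shows "V ** (W ** A ** transpose W) ** transpose V = A"
proof -
  have "V ** (W ** A ** transpose W) ** transpose V = (V ** W) ** A ** transpose (V ** W)"
    by (simp add: matrix_transpose_mul matrix_mul_assoc)
  then show ?thesis using assms by (simp add: transpose_mat)
qed

lemma pos_semidef_congruence_iff:
  fixes V :: "real ^ 'n ^ 'n"
  assumes "invertible V"
  shows "pos_semidef (V ** A ** transpose V) \<longleftrightarrow> pos_semidef A"
proof -
  obtain W where "W ** V = mat 1" using assms by (auto simp: invertible_def)
  then show ?thesis by (metis congruence_inverse pos_semidef_congruence)
qed

section \<open>Rank-one matrices and symmetric matrix units\<close>

definition outer :: "real ^ 'n \<Rightarrow> real ^ 'n ^ 'n" where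
  "outer w = (\<chi> i j. w $ i * w $ j)"

lemma outer_sym [simp]: "outer w \<in> sym_mats"
  by (simp add: sym_mats_iff outer_def)

lemma outer_mult_vec: "outer w *v x = (w \<bullet> x) *\<^sub>R w"
  by (simp add: outer_def matrix_vector_mult_def vec_eq_iff inner_vec_def sum_distrib_left mult_ac)

lemma congruence_outer:
  fixes V :: "real ^ 'n ^ 'n"
  shows "V ** outer w ** transpose V = outer (V *v w)"
  unfolding matrix_eq
  by (simp add: matrix_vector_mul_assoc [symmetric] outer_mult_vec matrix_vector_mult_scaleR)
    (metis dot_lmul_matrix inner_commute transpose_matrix_vector)

lemma pos_semidef_outer: "pos_semidef (outer w)"
  by (simp add: pos_semidef_def outer_mult_vec inner_commute)

text \<open>With this normalisation \<open>sym_unit i i\<close> is twice the diagonal unit.\<close>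

definition sym_unit :: "'n \<Rightarrow> 'n \<Rightarrow> real ^ 'n ^ 'n" where
  "sym_unit i j = (\<chi> k l. of_bool (k = i \<and> l = j) + of_bool (k = j \<and> l = i))"

lemma sym_unit_nth:
  "sym_unit i j $ k $ l = of_bool (k = i \<and> l = j) + of_bool (k = j \<and> l = i)"
  by (simp add: sym_unit_def)

lemma sym_unit_commute: "sym_unit i j = sym_unit j i"
  by (simp only: sym_unit_def add.commute)

lemma sym_unit_sym [simp]: "sym_unit i j \<in> sym_mats"
  unfolding sym_mats_iff sym_unit_nth by (simp only: conj_commute add.commute) simp

lemma sym_unit_diag: "sym_unit i i = 2 *\<^sub>R outer (axis i 1)"
  by (auto simp: vec_eq_iff sym_unit_nth outer_def axis_def)

text \<open>The factor 1/2 is uniform: each off-diagonal unit occurs twice in the double sum, and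
  each diagonal unit is doubled by the normalisation.\<close>

lemma sym_mats_eq_sum:
  assumes "A \<in> sym_mats"
  shows "A = (\<Sum>i\<in>UNIV. \<Sum>j\<in>UNIV. (A $ i $ j / 2) *\<^sub>R sym_unit i j)"
proof -
  have sym: "A $ l $ k = A $ k $ l" for k l
    using assms by (simp add: sym_mats_iff)
  have "(\<Sum>i\<in>UNIV. \<Sum>j\<in>UNIV. (A $ i $ j / 2) * sym_unit i j $ k $ l) = A $ k $ l" for k l
  proof -
    have "(\<Sum>i\<in>UNIV. \<Sum>j\<in>UNIV. (A $ i $ j / 2) * sym_unit i j $ k $ l) =
      (\<Sum>i\<in>UNIV. \<Sum>j\<in>UNIV. (if i = k then if j = l then A $ i $ j / 2 else 0 else 0)) +
      (\<Sum>i\<in>UNIV. \<Sum>j\<in>UNIV. (if i = l then if j = k then A $ i $ j / 2 else 0 else 0))"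
      unfolding sum.distrib [symmetric]
      by (intro sum.cong refl) (auto simp: sym_unit_nth)
    also have "\<dots> = A $ k $ l"
      using sym [of k l] by (simp add: if_distrib [where f = "sum _"] sum.delta' cong: if_cong) (simp add: sum.If_cases)
    finally show ?thesis .
  qed
  then show ?thesis by (simp add: vec_eq_iff sum_component)
qed

text \<open>The combination is twice the rank-one matrix of
  \<open>axis i 1 + s *\<^sub>R axis j 1\<close>. Letting \<open>s\<close> vary gives test matrices
  for operators that fix the diagonal units.\<close>

lemma pos_semidef_sym_unit_combination:
  "pos_semidef (sym_unit i i + (2 * s) *\<^sub>R sym_unit i j + s\<^sup>2 *\<^sub>R sym_unit j j)"
proof -
  have "sym_unit i i + (2 * s) *\<^sub>R sym_unit i j + s\<^sup>2 *\<^sub>R sym_unit j j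
    = 2 *\<^sub>R outer (axis i 1 + s *\<^sub>R axis j 1)"
    by (auto simp: vec_eq_iff sym_unit_nth outer_def axis_def power2_eq_square algebra_simps)
  moreover have "pos_semidef (2 *\<^sub>R outer w)" for w :: "real ^ 'a"
    using pos_semidef_outer [of w] subspace_scale [OF subspace_sym_mats outer_sym]
    by (simp add: pos_semidef_def scaleR_matrix_vector_assoc [symmetric])
  ultimately show ?thesis by simp
qed

section \<open>Operators fixing the diagonal units\<close>

text \<open>The images of the rank-one test matrices confine the support of
  \<open>S (sym_unit i j)\<close> and bound its coefficient by 1 in absolute value; reflecting
  semidefiniteness back through \<open>S\<close> gives the opposite bound.\<close>

lemma sym_unit_image:
  fixes S :: "real ^ 'n ^ 'n \<Rightarrow> real ^ 'n ^ 'n"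
  assumes lin: "linear S"
    and psd: "\<And>A. A \<in> sym_mats \<Longrightarrow> pos_semidef (S A) \<longleftrightarrow> pos_semidef A"
    and diag: "\<And>i. S (sym_unit i i) = sym_unit i i"
    and sym: "\<And>A. A \<in> sym_mats \<Longrightarrow> S A \<in> sym_mats"
    and ij: "i \<noteq> j"
  obtains c where "c\<^sup>2 = 1" "S (sym_unit i j) = c *\<^sub>R sym_unit i j"
proof -
  define M where "M = S (sym_unit i j)"
  have comb_sym: "sym_unit i i + a *\<^sub>R sym_unit i j + b *\<^sub>R sym_unit j j \<in> sym_mats" for a b
    by (intro subspace_add subspace_scale subspace_sym_mats sym_unit_sym)
  have S_comb: "S (sym_unit i i + a *\<^sub>R sym_unit i j + b *\<^sub>R sym_unit j j)
      = sym_unit i i + a *\<^sub>R M + b *\<^sub>R sym_unit j j" for a b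
    by (simp add: linear_add [OF lin] linear_scale [OF lin] diag M_def)
  have M_psd: "pos_semidef (sym_unit i i + (2 * s) *\<^sub>R M + s\<^sup>2 *\<^sub>R sym_unit j j)" for s
    using psd [OF comb_sym] pos_semidef_sym_unit_combination S_comb by metis
  have M_diag: "0 \<le> sym_unit i i $ k $ k + (2 * s) * M $ k $ k + s\<^sup>2 * sym_unit j j $ k $ k" for s k
    using pos_semidef_diag [OF M_psd, of s k] by simp
  have M_sym: "M $ k $ l = M $ l $ k" for k l
    using sym [OF sym_unit_sym] by (simp add: M_def sym_mats_iff)
  \<comment> \<open>The inequality \<open>M_diag\<close> reads \<open>0 \<le> 2 + 2 * s * m\<close>
    at \<open>i\<close>, \<open>0 \<le> 2 * s * m + 2 * s * s\<close> at \<open>j\<close> and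
    \<open>0 \<le> 2 * s * m\<close> elsewhere, with \<open>m\<close> the diagonal entry. Each
    forces \<open>m = 0\<close> as \<open>s\<close> varies.\<close>
  have M0: "M $ k $ k = 0" for k
  proof (cases "k = i")
    case True
    show ?thesis
    proof (rule ccontr)
      assume "M $ k $ k \<noteq> 0"
      then show False using M_diag [of k "- 2 / M $ k $ k"] True ij by (simp add: sym_unit_nth)
    qed
  next
    case ki: False
    show ?thesis
    proof (cases "k = j")
      case True
      have "0 \<le> - (M $ k $ k)\<^sup>2"
        using M_diag [of k "- M $ k $ k / 2"] True ij
        by (simp add: sym_unit_nth power2_eq_square)
      then show ?thesis by simp
    next
      case False
      then show ?thesis using M_diag [of k 1] M_diag [of k "-1"] ki
        by (simp add: sym_unit_nth)
    qed
  qed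
  \<comment> \<open>Outside \<open>i\<close> and \<open>j\<close> the test image has a zero diagonal
    entry, so its whole row vanishes.\<close>
  have Mrow: "M $ k $ l = 0" if "k \<noteq> i" "k \<noteq> j" for k l
    using pos_semidef_minor [OF M_psd, of 1 k l] that M0 [of k] by (simp add: sym_unit_nth)
  define c where "c = M $ i $ j"
  have "M $ k $ l = c * sym_unit i j $ k $ l" for k l
  proof -
    consider "k \<noteq> i" "k \<noteq> j" | "l \<noteq> i" "l \<noteq> j" | "k = l" | "k = i" "l = j" | "k = j" "l = i"
      by blast
    then show ?thesis
    proof cases
      case 1
      then show ?thesis by (simp add: Mrow sym_unit_nth)
    next
      case 2
      then show ?thesis using M_sym [of k l] by (simp add: Mrow sym_unit_nth)
    next
      case 3
      then show ?thesis using ij by (auto simp: M0 sym_unit_nth)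
    next
      case 4
      then show ?thesis using ij by (simp add: c_def sym_unit_nth)
    next
      case 5
      then show ?thesis using ij M_sym [of i j] by (simp add: c_def sym_unit_nth)
    qed
  qed
  then have M_eq: "M = c *\<^sub>R sym_unit i j" by (simp add: vec_eq_iff)
  have "(2 * c)\<^sup>2 \<le> 4"
    using pos_semidef_minor [OF M_psd, of 1 i j] ij M0 by (simp add: sym_unit_nth c_def)
  then have le: "c\<^sup>2 \<le> 1" by (simp add: power_mult_distrib)
  have "c \<noteq> 0"
  proof
    assume "c = 0"
    then have "S (sym_unit i j) = 0" using M_eq by (simp add: M_def)
    moreover have "pos_semidef (0 :: real ^ 'n ^ 'n)" by (simp add: pos_semidef_def sym_mats_iff)
    ultimately have "pos_semidef (sym_unit i j)" using psd [OF sym_unit_sym] by metis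
    then show False using pos_semidef_minor [of "sym_unit i j" i j] ij by (simp add: sym_unit_nth)
  qed
  \<comment> \<open>Since \<open>(2 / c) *\<^sub>R M\<close> is twice \<open>sym_unit i j\<close>,
    this is the test matrix for \<open>s = 1\<close>. It is also the image of the same expression
    with \<open>sym_unit i j\<close> in place of \<open>M\<close>, whose minor yields
    \<open>1 \<le> c * c\<close>.\<close>
  have "pos_semidef (sym_unit i i + (2 / c) *\<^sub>R M + sym_unit j j)"
    using pos_semidef_sym_unit_combination [of i 1 j] M_eq \<open>c \<noteq> 0\<close> by simp
  then have "pos_semidef (sym_unit i i + (2 / c) *\<^sub>R sym_unit i j + sym_unit j j)"
    using psd [OF comb_sym [of "2 / c" 1]] S_comb [of "2 / c" 1] by simp
  from pos_semidef_minor [OF this, of i j] have "(2 / c)\<^sup>2 \<le> 4"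
    using ij by (simp add: sym_unit_nth)
  then have "1 \<le> c\<^sup>2" using \<open>c \<noteq> 0\<close> by (simp add: power_divide field_simps)
  with le have "c\<^sup>2 = 1" by simp
  then show thesis using that M_eq by (simp add: M_def)
qed

text \<open>\<open>S\<close> multiplies entries by a symmetric matrix of signs \<open>c\<close>. The
  image of the all-ones matrix is \<open>c\<close> itself, and a semidefinite sign matrix with unit
  diagonal has rank one.\<close>

lemma diagonal_fixing_operator:
  fixes S :: "real ^ 'n ^ 'n \<Rightarrow> real ^ 'n ^ 'n"
  assumes lin: "linear S"
    and psd: "\<And>A. A \<in> sym_mats \<Longrightarrow> pos_semidef (S A) \<longleftrightarrow> pos_semidef A"
    and diag: "\<And>i. S (sym_unit i i) = sym_unit i i"
    and sym: "\<And>A. A \<in> sym_mats \<Longrightarrow> S A \<in> sym_mats"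
  shows "\<exists>d. (\<forall>i. (d i)\<^sup>2 = 1) \<and> (\<forall>A\<in>sym_mats. S A = (\<chi> k l. d k * d l * A $ k $ l))"
proof -
  have "\<exists>c. c\<^sup>2 = 1 \<and> S (sym_unit i j) = c *\<^sub>R sym_unit i j" for i j
  proof (cases "i = j")
    case True
    then show ?thesis using diag by (intro exI [of _ 1]) auto
  next
    case False
    then show ?thesis using sym_unit_image [OF lin psd diag sym] by metis
  qed
  then obtain c where c: "(c i j)\<^sup>2 = 1" "S (sym_unit i j) = c i j *\<^sub>R sym_unit i j" for i j
    by metis
  have c_sym: "c i j = c j i" for i j
  proof -
    have "c i j *\<^sub>R sym_unit i j = c j i *\<^sub>R sym_unit i j"
      using c(2) [of i j] c(2) [of j i] by (simp only: sym_unit_commute)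
    then have "c i j * sym_unit i j $ i $ j = c j i * sym_unit i j $ i $ j"
      by (metis vector_scaleR_component real_scaleR_def)
    moreover have "sym_unit i j $ i $ j \<noteq> 0" by (auto simp: sym_unit_nth)
    ultimately show ?thesis by simp
  qed
  have S_nth: "S A $ k $ l = c k l * A $ k $ l" if A: "A \<in> sym_mats" for A k l
  proof -
    define B :: "real ^ 'n ^ 'n" where "B = (\<chi> i j. c i j * A $ i $ j)"
    have "B \<in> sym_mats" using A c_sym by (simp add: B_def sym_mats_iff)
    have "S A = S (\<Sum>i\<in>UNIV. \<Sum>j\<in>UNIV. (A $ i $ j / 2) *\<^sub>R sym_unit i j)"
      using sym_mats_eq_sum [OF A] by simp
    also have "\<dots> = (\<Sum>i\<in>UNIV. \<Sum>j\<in>UNIV. (B $ i $ j / 2) *\<^sub>R sym_unit i j)"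
      by (simp add: linear_sum [OF lin] linear_scale [OF lin] c B_def mult_ac)
    also have "\<dots> = B" using sym_mats_eq_sum [OF \<open>B \<in> sym_mats\<close>] by simp
    finally show ?thesis by (simp add: B_def)
  qed
  have c_diag: "c i i = 1" for i
    using S_nth [OF sym_unit_sym [of i i], of i i] diag [of i] by (simp add: sym_unit_nth)
  define J :: "real ^ 'n ^ 'n" where "J = outer (\<chi> i. 1)"
  have J1: "J $ i $ j = 1" for i j by (simp add: J_def outer_def)
  have SJ: "S J $ k $ l = c k l" for k l
    using S_nth [of J k l] J1 by (simp add: J_def)
  have "pos_semidef (S J)" using psd [of J] pos_semidef_outer J_def by auto
  have c_mult: "c k i = c i j * c k j" for i j k
  proof -
    \<comment> \<open>This \<open>u\<close> is isotropic for \<open>S J\<close> because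
      \<open>c i j\<close> squares to 1, so it lies in the kernel; coordinate \<open>k\<close> of
      the kernel equation is the claim.\<close>
    define u :: "real ^ 'n" where "u = axis i 1 - c i j *\<^sub>R axis j 1"
    have Su: "S J *v u = column i (S J) - c i j *\<^sub>R column j (S J)"
      by (simp add: u_def matrix_vector_mult_diff_distrib matrix_vector_mult_scaleR matrix_vector_mult_basis)
    have "u \<bullet> (S J *v u) = 1 - (c i j)\<^sup>2"
      using c(1) [of i j] c_sym [of i j]
      by (simp add: Su) (simp add: u_def inner_diff inner_axis' column_def SJ c_diag power2_eq_square
          algebra_simps)
    then have "S J *v u = 0"
      using pos_semidef_null [OF \<open>pos_semidef (S J)\<close>] c(1) by simp
    then have "(S J *v u) $ k = 0" by simp
    then show ?thesis by (simp add: Su column_def SJ)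
  qed
  \<comment> \<open>Any column of the sign matrix can serve as the vector \<open>d\<close>, so an
    arbitrary index is fixed.\<close>
  obtain k0 :: 'n where True by simp
  show ?thesis
  proof (intro exI [of _ "\<lambda>i. c i k0"] conjI allI ballI)
    show "(c i k0)\<^sup>2 = 1" for i by (rule c)
    show "S A = (\<chi> k l. c k k0 * c l k0 * A $ k $ l)" if "A \<in> sym_mats" for A
    proof -
      have "c k l = c k k0 * c l k0" for k l
        by (rule trans [OF c_mult [of k l k0] mult.commute])
      then have "S A $ k $ l = c k k0 * c l k0 * A $ k $ l" for k l
        unfolding S_nth [OF that] by (rule arg_cong)
      then show ?thesis by (simp add: vec_eq_iff)
    qed
  qed
qed

section \<open>Extreme rays\<close>

text \<open>Take \<open>w\<close> to be \<open>B *v u\<close> divided by the root of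
  \<open>u \<bullet> (B *v u)\<close>; Cauchy-Schwarz then bounds the form of \<open>outer w\<close>
  by that of \<open>B\<close>. Equality at \<open>u\<close> fixes the scale of \<open>w\<close> for
  later comparison.\<close>

lemma outer_le_pos_semidef:
  fixes B :: "real ^ 'n ^ 'n"
  assumes B: "pos_semidef B" "B \<noteq> 0"
  obtains u w where "pos_semidef (B - outer w)" "u \<bullet> (B *v u) > 0" "(w \<bullet> u)\<^sup>2 = u \<bullet> (B *v u)"
proof -
  have "\<exists>u. u \<bullet> (B *v u) \<noteq> 0"
  proof (rule ccontr)
    assume "\<not> ?thesis"
    then have "B *v x = 0 *v x" for x using pos_semidef_null [OF B(1)] by simp
    then show False using B(2) matrix_eq by blast
  qed
  then obtain u where "u \<bullet> (B *v u) \<noteq> 0" ..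
  then have pos: "u \<bullet> (B *v u) > 0" using B(1) by (metis pos_semidef_def order_le_less)
  define b where "b = u \<bullet> (B *v u)"
  define w where "w = (1 / sqrt b) *\<^sub>R (B *v u)"
  have b: "b > 0" using pos b_def by simp
  have wx: "(w \<bullet> x)\<^sup>2 = (x \<bullet> (B *v u))\<^sup>2 / b" for x
    using b by (simp add: w_def power_divide power_mult_distrib inner_commute)
  have "0 \<le> x \<bullet> ((B - outer w) *v x)" for x
  proof -
    have "x \<bullet> ((B - outer w) *v x) = x \<bullet> (B *v x) - (w \<bullet> x)\<^sup>2"
      by (simp add: matrix_vector_mult_diff_rdistrib outer_mult_vec inner_diff inner_commute
          power2_eq_square)
    moreover have "(w \<bullet> x)\<^sup>2 \<le> x \<bullet> (B *v x)"
      using pos_semidef_Cauchy_Schwarz [OF B(1), of x u] b by (simp add: wx b_def divide_le_eq)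
    ultimately show ?thesis by simp
  qed
  moreover have "B - outer w \<in> sym_mats"
    using B(1) by (simp add: pos_semidef_def subspace_diff [OF subspace_sym_mats])
  ultimately have "pos_semidef (B - outer w)" by (simp add: pos_semidef_def)
  moreover have "(w \<bullet> u)\<^sup>2 = u \<bullet> (B *v u)"
    unfolding wx b_def [symmetric] using b by (simp add: power2_eq_square)
  ultimately show thesis using that pos by blast
qed

text \<open>Diagonal entries of \<open>P\<close> other than the one at \<open>i\<close> are squeezed
  to zero, and the 2 by 2 minors then remove every other entry outside position
  \<open>(i, i)\<close>.\<close>

lemma outer_axis_extreme:
  fixes P :: "real ^ 'n ^ 'n"
  assumes P: "pos_semidef P" and Q: "pos_semidef (outer (axis i 1) - P)"
  obtains p where "P = p *\<^sub>R outer (axis i 1)"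
proof
  have "P $ k $ k = 0" if "k \<noteq> i" for k
    using that pos_semidef_diag [OF P, of k] pos_semidef_diag [OF Q, of k]
    by (simp add: outer_def axis_def)
  then have "P $ k $ l = 0" if "k \<noteq> i \<or> l \<noteq> i" for k l
    using that pos_semidef_minor [OF P, of k l] by auto
  then show "P = P $ i $ i *\<^sub>R outer (axis i 1)"
    by (auto simp: vec_eq_iff outer_def axis_def)
qed

text \<open>A rank-one matrix below \<open>T E\<close> pulls back to a semidefinite matrix below
  \<open>E\<close>, which extremality makes a multiple of \<open>E\<close>.\<close>

lemma outer_axis_image:
  fixes T :: "real ^ 'n ^ 'n \<Rightarrow> real ^ 'n ^ 'n"
  assumes lin: "linear T" and inj: "inj T"
    and psd: "\<And>A. A \<in> sym_mats \<Longrightarrow> pos_semidef (T A) \<longleftrightarrow> pos_semidef A"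
    and onto: "\<And>B. B \<in> sym_mats \<Longrightarrow> \<exists>A\<in>sym_mats. T A = B"
  obtains w where "T (outer (axis i 1)) = outer w"
proof -
  define E :: "real ^ 'n ^ 'n" where "E = outer (axis i 1)"
  have "E $ i $ i = 1" by (simp add: E_def outer_def axis_def)
  then have "E \<noteq> 0" by auto
  then have "T E \<noteq> 0" using linear_injective_0 [OF lin] inj by blast
  moreover have "pos_semidef (T E)" using psd pos_semidef_outer by (simp add: E_def)
  ultimately obtain u w where w: "pos_semidef (T E - outer w)" "u \<bullet> (T E *v u) > 0"
      "(w \<bullet> u)\<^sup>2 = u \<bullet> (T E *v u)"
    using outer_le_pos_semidef by metis
  obtain P where P: "P \<in> sym_mats" "T P = outer w" using onto [OF outer_sym] by metis
  have "pos_semidef P" using psd P pos_semidef_outer by metis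
  moreover have "pos_semidef (E - P)"
    using psd [of "E - P"] w(1) P
    by (simp add: linear_diff [OF lin] subspace_diff [OF subspace_sym_mats] E_def)
  ultimately obtain p where "P = p *\<^sub>R E" using outer_axis_extreme by (metis E_def)
  then have eq: "outer w = p *\<^sub>R T E" using P(2) linear_scale [OF lin] by metis
  have "(w \<bullet> u)\<^sup>2 = u \<bullet> (outer w *v u)"
    by (simp add: outer_mult_vec inner_commute power2_eq_square)
  also have "\<dots> = p * (u \<bullet> (T E *v u))"
    by (simp add: eq scaleR_matrix_vector_assoc [symmetric])
  \<comment> \<open>\<open>outer w\<close> and \<open>T E\<close> take the same positive value at
    \<open>u\<close>, so the factor is 1.\<close>
  finally have "p = 1" using w(2,3) by simp
  with eq have "T (outer (axis i 1)) = outer w" by (simp add: E_def)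
  then show thesis by (rule that)
qed

section \<open>Automorphisms of the semidefinite cone\<close>

lemma pos_semidef_automorphism:
  fixes T :: "real ^ 'n ^ 'n \<Rightarrow> real ^ 'n ^ 'n"
  assumes lin: "linear T" and inj: "inj T"
    and psd: "\<And>A. A \<in> sym_mats \<Longrightarrow> pos_semidef (T A) \<longleftrightarrow> pos_semidef A"
    and sym: "\<And>A. A \<in> sym_mats \<Longrightarrow> T A \<in> sym_mats"
    and onto: "\<And>B. B \<in> sym_mats \<Longrightarrow> \<exists>A\<in>sym_mats. T A = B"
    and one: "T (mat 1) \<in> pos_def_mats"
  shows "\<exists>W. invertible W \<and> (\<forall>A\<in>sym_mats. T A = W ** A ** transpose W)"
proof -
  have "\<exists>w. T (outer (axis i 1)) = outer w" for i
    using outer_axis_image [OF lin inj psd onto] by metis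
  then obtain w where w: "T (outer (axis i 1)) = outer (w i)" for i
    by metis
  define W :: "real ^ 'n ^ 'n" where "W = (\<chi> k i. w i $ k)"
  have Wcol: "W *v axis i 1 = w i" for i
    by (simp add: matrix_vector_mult_basis column_def W_def vec_eq_iff)
  have "(mat 1 :: real ^ 'n ^ 'n) = (\<Sum>i\<in>UNIV. outer (axis i 1))"
  proof -
    have "(\<Sum>i\<in>UNIV. outer (axis i 1)) $ k $ l = (mat 1 :: real ^ 'n ^ 'n) $ k $ l" for k l
    proof -
      have "(\<Sum>i\<in>UNIV. outer (axis i 1)) $ k $ l
          = (\<Sum>i\<in>UNIV. if i = k then if k = l then 1 else 0 else (0 :: real))"
        unfolding sum_component by (intro sum.cong refl) (auto simp: outer_def axis_def)
      then show ?thesis by (simp add: mat_def)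
    qed
    then show ?thesis by (simp add: vec_eq_iff)
  qed
  then have T1: "T (mat 1) = (\<Sum>i\<in>UNIV. outer (w i))"
    by (simp add: linear_sum [OF lin] w)
  \<comment> \<open>A kernel vector of \<open>transpose W\<close> is orthogonal to every
    \<open>w i\<close>, hence is annihilated by \<open>T (mat 1)\<close>, which is definite.\<close>
  have "x = 0" if "transpose W *v x = 0" for x
  proof -
    have "w i \<bullet> x = 0" for i
      using that by (metis Wcol dot_lmul_matrix inner_zero_left inner_commute transpose_matrix_vector
          transpose_transpose)
    moreover have "T (mat 1) *v x = (\<Sum>i\<in>UNIV. outer (w i) *v x)"
      unfolding T1 by (rule linear_sum [of "\<lambda>A. A *v x"])
        (rule linearI, simp_all add: matrix_vector_mult_add_rdistrib scaleR_matrix_vector_assoc)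
    ultimately have "T (mat 1) *v x = 0" by (simp add: outer_mult_vec)
    then show ?thesis using one by (auto simp: pos_def_mats_def)
  qed
  then have "invertible (transpose W)"
    by (metis invertible_left_inverse matrix_left_invertible_ker)
  then have invW: "invertible W" by (metis transpose_invertible transpose_transpose)
  then obtain V where V: "V ** W = mat 1" "W ** V = mat 1" by (auto simp: invertible_def)
  then have invV: "invertible V" by (auto simp: invertible_def)
  define S where "S A = V ** T A ** transpose V" for A
  have S_lin: "linear S"
    by (rule linearI) (simp_all add: S_def linear_add [OF lin] linear_scale [OF lin]
        matrix_add_ldistrib matrix_add_rdistrib scalar_matrix_assoc matrix_scalar_ac)
  have S_psd: "pos_semidef (S A) \<longleftrightarrow> pos_semidef A" if "A \<in> sym_mats" for A
    using psd [OF that] pos_semidef_congruence_iff [OF invV] by (simp add: S_def)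
  have S_diag: "S (sym_unit i i) = sym_unit i i" for i
  proof -
    have "S (outer (axis i 1)) = outer (V *v (W *v axis i 1))"
      by (simp add: S_def w congruence_outer Wcol)
    also have "\<dots> = outer (axis i 1)" by (simp add: matrix_vector_mul_assoc V)
    finally show ?thesis by (simp add: sym_unit_diag linear_scale [OF S_lin])
  qed
  have S_sym: "S A \<in> sym_mats" if "A \<in> sym_mats" for A
    using sym [OF that] by (simp add: S_def congruence_sym_mats)
  obtain d where d: "\<And>i. (d i)\<^sup>2 = 1"
      "\<And>A. A \<in> sym_mats \<Longrightarrow> S A = (\<chi> k l. d k * d l * A $ k $ l)"
    using diagonal_fixing_operator [OF S_lin S_psd S_diag S_sym] by auto
  define D :: "real ^ 'n ^ 'n" where "D = (\<chi> i j. if i = j then d i else 0)"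
  have D_mult: "(D ** A) $ i $ j = d i * A $ i $ j" for A i j
  proof -
    have "(D ** A) $ i $ j = (\<Sum>k\<in>UNIV. if k = i then d i * A $ i $ j else 0)"
      unfolding D_def matrix_matrix_mult_def vec_lambda_beta by (rule sum.cong) auto
    then show ?thesis by simp
  qed
  have DD: "D ** D = mat 1"
    using d(1) by (simp add: vec_eq_iff D_mult) (simp add: D_def mat_def power2_eq_square)
  have D_conj: "D ** A ** transpose D = (\<chi> k l. d k * d l * A $ k $ l)" for A
  proof -
    \<comment> \<open>Transposing turns the right multiplication by \<open>transpose D\<close> into
      a left multiplication by \<open>D\<close>, which \<open>D_mult\<close> covers.\<close>
    have "D ** A ** transpose D = transpose (D ** transpose (D ** A))"
      by (simp add: matrix_transpose_mul)
    also have "\<dots> = (\<chi> k l. d k * d l * A $ k $ l)"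
      by (simp add: vec_eq_iff transpose_def D_mult)
    finally show ?thesis .
  qed
  have "T A = (W ** D) ** A ** transpose (W ** D)" if "A \<in> sym_mats" for A
  proof -
    have "T A = W ** S A ** transpose W"
      using congruence_inverse [OF V(2), of "T A"] by (simp add: S_def)
    also have "S A = D ** A ** transpose D" using d(2) [OF that] D_conj by simp
    finally show ?thesis by (simp add: matrix_transpose_mul matrix_mul_assoc)
  qed
  moreover have "invertible (W ** D)"
    by (rule invertible_mult [OF invW]) (use DD in \<open>auto simp: invertible_def\<close>)
  ultimately show ?thesis by blast
qed

text \<open>An operator on symmetric matrices is extended to all matrices by the identity on the
  skew-symmetric ones, so that the theory of linear maps on a whole space applies.\<close>

lemma linear_extension_of_sym_operator:
  fixes T :: "real ^ 'n ^ 'n \<Rightarrow> real ^ 'n ^ 'n"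
  assumes T: "linear_operator_on_sym_mats T"
    and inj: "\<And>A. A \<in> sym_mats \<Longrightarrow> T A = 0 \<Longrightarrow> A = 0"
  shows "\<exists>T'. linear T' \<and> inj T' \<and> (\<forall>A\<in>sym_mats. T' A = T A) \<and>
    (\<forall>B\<in>sym_mats. \<exists>A\<in>sym_mats. T' A = B)"
proof -
  define p q :: "real ^ 'n ^ 'n \<Rightarrow> real ^ 'n ^ 'n"
    where "p A = (1 / 2) *\<^sub>R (A + transpose A)" and "q A = (1 / 2) *\<^sub>R (A - transpose A)" for A
  define T' where "T' A = T (p A) + q A" for A
  have p_sym: "p A \<in> sym_mats" for A
    by (simp add: p_def sym_mats_iff transpose_def)
  have pq: "p A + q A = A" for A
    by (simp add: p_def q_def vec_eq_iff field_simps)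
  have on_sym: "p A = A" "q A = 0" if "A \<in> sym_mats" for A
    using that by (simp_all add: p_def q_def sym_mats_def scaleR_2 [symmetric])
  have lin_pq: "linear p" "linear q"
    by (auto intro!: linearI simp: p_def q_def vec_eq_iff transpose_def algebra_simps)
  have T_sym: "T A \<in> sym_mats" if "A \<in> sym_mats" for A
    using T that by (auto simp: linear_operator_on_sym_mats_def)
  have T0: "T 0 = 0"
    using T subspace_0 [OF subspace_sym_mats] unfolding linear_operator_on_sym_mats_def
    by (metis scaleR_zero_left)
  have lin: "linear T'"
    using T p_sym by (intro linearI) (simp_all add: T'_def linear_operator_on_sym_mats_def
        linear_add [OF lin_pq(1)] linear_add [OF lin_pq(2)]
        linear_scale [OF lin_pq(1)] linear_scale [OF lin_pq(2)] scaleR_add_right)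
  \<comment> \<open>If \<open>T' A\<close> is symmetric, then so is the skew part
    \<open>q A\<close>, which must therefore vanish.\<close>
  have q_zero: "q A = 0" if "T' A \<in> sym_mats" for A
  proof -
    have "q A = T' A - T (p A)" by (simp add: T'_def)
    then have "q A \<in> sym_mats"
      using that T_sym [OF p_sym] subspace_diff [OF subspace_sym_mats] by metis
    then have "q (q A) = 0" using on_sym(2) by blast
    moreover have "q (q A) = q A" by (simp add: q_def vec_eq_iff transpose_def field_simps)
    ultimately show ?thesis by simp
  qed
  have preimage: "A \<in> sym_mats" if "T' A \<in> sym_mats" for A
    using q_zero [OF that] pq [of A] p_sym [of A] by simp
  have T'_eq: "T' A = T A" if "A \<in> sym_mats" for A
    using on_sym [OF that] by (simp add: T'_def)
  have "inj T'"
    unfolding linear_injective_0 [OF lin]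
    using inj preimage T'_eq subspace_0 [OF subspace_sym_mats] by metis
  moreover have "\<exists>A\<in>sym_mats. T' A = B" if "B \<in> sym_mats" for B
    using linear_injective_imp_surjective [OF lin \<open>inj T'\<close>] preimage that by (metis surjD)
  ultimately show ?thesis using lin T'_eq by blast
qed

theorem theorem12:
  fixes T :: "real ^ 'n ^ 'n \<Rightarrow> real ^ 'n ^ 'n"
  assumes "linear_operator_on_sym_mats T"
    and "preserves_pos_def T"
  shows "{A \<in> sym_mats. T A \<in> pos_def_mats} \<subseteq> pos_def_mats \<longleftrightarrow>
    (\<exists>W :: real ^ 'n ^ 'n. invertible W \<and>
       (\<forall>A\<in>sym_mats. T A = W ** A ** transpose W))"
proof
  assume "{A \<in> sym_mats. T A \<in> pos_def_mats} \<subseteq> pos_def_mats"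
  then have pd: "T A \<in> pos_def_mats \<longleftrightarrow> A \<in> pos_def_mats" if "A \<in> sym_mats" for A
    using assms(2) that by (auto simp: preserves_pos_def_def)
  have T_sym: "T A \<in> sym_mats" if "A \<in> sym_mats" for A
    using assms(1) that by (auto simp: linear_operator_on_sym_mats_def)
  have one: "mat 1 \<in> pos_def_mats" by (simp add: pos_def_mats_def)
  have comb: "A + e *\<^sub>R mat 1 \<in> sym_mats" "T (A + e *\<^sub>R mat 1) = T A + e *\<^sub>R T (mat 1)"
    if "A \<in> sym_mats" for A e
    using assms(1) that
    by (simp_all add: linear_operator_on_sym_mats_def subspace_add [OF subspace_sym_mats]
        subspace_scale [OF subspace_sym_mats])
  have psd: "pos_semidef (T A) \<longleftrightarrow> pos_semidef A" if "A \<in> sym_mats" for A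
  proof -
    have "T (mat 1) \<in> pos_def_mats" using pd one by simp
    from pos_semidef_iff_perturb [OF T_sym [OF that] this]
    have "pos_semidef (T A) \<longleftrightarrow> (\<forall>e>0. T (A + e *\<^sub>R mat 1) \<in> pos_def_mats)"
      unfolding comb(2) [OF that] .
    then show ?thesis
      unfolding pd [OF comb(1) [OF that]] pos_semidef_iff_perturb [OF that one] .
  qed
  \<comment> \<open>If \<open>T\<close> kills \<open>A\<close>, then \<open>A\<close> and
    \<open>- A\<close> both map to the semidefinite matrix 0, so both are semidefinite and the form
    of \<open>A\<close> vanishes identically.\<close>
  have inj: "A = 0" if A: "A \<in> sym_mats" "T A = 0" for A
  proof -
    have nA: "- A \<in> sym_mats" "T (- A) = 0"
      using A assms(1) unfolding linear_operator_on_sym_mats_def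
      by (metis subspace_neg [OF subspace_sym_mats], metis scaleR_minus1_left scaleR_zero_right)
    have "pos_semidef (0 :: real ^ 'n ^ 'n)" by (simp add: pos_semidef_def sym_mats_iff)
    then have "pos_semidef A" "pos_semidef (- A)"
      using psd A nA by metis+
    then have "x \<bullet> (A *v x) = 0" for x
      by (metis (no_types) add.right_inverse pos_semidef_def matrix_vector_mult_add_rdistrib
          inner_add_right matrix_vector_mult_0 inner_zero_right add_nonneg_eq_0_iff)
    then have "A *v x = 0 *v x" for x
      using pos_semidef_null [OF \<open>pos_semidef A\<close>] by simp
    then show ?thesis using matrix_eq by blast
  qed
  obtain T' where T': "linear T'" "inj T'" "\<And>A. A \<in> sym_mats \<Longrightarrow> T' A = T A"
    "\<And>B. B \<in> sym_mats \<Longrightarrow> \<exists>A\<in>sym_mats. T' A = B"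
    using linear_extension_of_sym_operator [OF assms(1) inj] by auto
  have "\<exists>W. invertible W \<and> (\<forall>A\<in>sym_mats. T' A = W ** A ** transpose W)"
    using T'(3) psd T_sym pd one by (intro pos_semidef_automorphism T'(1,2,4)) simp_all
  then show "\<exists>W. invertible W \<and> (\<forall>A\<in>sym_mats. T A = W ** A ** transpose W)"
    using T'(3) by auto
next
  assume "\<exists>W. invertible W \<and> (\<forall>A\<in>sym_mats. T A = W ** A ** transpose W)"
  then obtain W where W: "invertible W" "\<And>A. A \<in> sym_mats \<Longrightarrow> T A = W ** A ** transpose W"
    by blast
  obtain V where V: "V ** W = mat 1" using W(1) by (auto simp: invertible_def)
  show "{A \<in> sym_mats. T A \<in> pos_def_mats} \<subseteq> pos_def_mats"
  proof clarify
    fix A assume A: "A \<in> sym_mats" "T A \<in> pos_def_mats"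
    have "x \<bullet> (A *v x) > 0" if "x \<noteq> 0" for x
    proof -
      \<comment> \<open>Every nonzero \<open>x\<close> is \<open>transpose W *v y\<close> for this
        nonzero \<open>y\<close>, so the form of \<open>A\<close> at \<open>x\<close> equals that of
        \<open>T A\<close> at \<open>y\<close>.\<close>
      define y where "y = transpose V *v x"
      have "transpose W ** transpose V = mat 1"
        by (simp add: matrix_transpose_mul [symmetric] V transpose_mat)
      then have y: "transpose W *v y = x"
        by (simp only: y_def matrix_vector_mul_assoc matrix_vector_mul_lid)
      then have "y \<noteq> 0" using that by auto
      then have "0 < y \<bullet> (T A *v y)" using A(2) by (auto simp: pos_def_mats_def)
      also have "\<dots> = x \<bullet> (A *v x)" by (simp only: W(2) [OF A(1)] inner_congruence y)
      finally show ?thesis .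
    qed
    then show "A \<in> pos_def_mats" using A(1) by (simp add: pos_def_mats_def)
  qed
qed

end
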